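(* Let $G$ be a finite simple oriented graph with a fully traversable pebbling assignment $(S_G)$. If the underlying undirected graph of $G$ contains a cycle, then $G$ is not isomorphic (as a directed graph) to $[S_G]$.
   Context: An oriented graph is a directed graph with no loops, no multiple edges and no pair of opposite edges. A pebbling assignment $(S_G)$ on $G$ assigns a nonnegative integer number of pebbles to each vertex. A pebbling move along an edge $(v,w)$ (allowed when $v$ has at least two pebbles) removes two pebbles from $v$ and adds one pebble to $w$. The assignment graph $[S_G]$ is the directed graph whose vertices are all assignments obtainable from $(S_G)$ by finite sequences of pebbling moves (including $(S_G)$ itself), with a directed edge from $A$ to $B$ whenever $B$ is obtained from $A$ by a single pebbling move. $(S_G)$ is fully traversable if $G$ has at least one edge and for every edge $(v,w)$ of $G$ some assignment reachable from $(S_G)$ admits a pebbling move along $(v,w)$. *)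

theory Defs
  imports "Graph_Theory.Graph_Theory"
begin

text \<open>Arcs are pairs of vertices, so multiple edges are excluded by the representation;
  \<^const>\<open>pair_digraph\<close> adds finiteness and the absence of loops.\<close>

definition finite_oriented_graph :: "'a pair_pre_digraph \<Rightarrow> bool" where
  "finite_oriented_graph G \<longleftrightarrow>
     pair_digraph G \<and> (\<forall>u v. (u, v) \<in> parcs G \<longrightarrow> (v, u) \<notin> parcs G)"

text \<open>In the symmetric digraph \<^term>\<open>mk_symmetric G\<close> the closed walk \<open>u, v, u\<close> along a single
  undirected edge is a \<^const>\<open>pre_digraph.cycle\<close>; cycles of a simple undirected graph are those
  of length at least 3.\<close>

definition underlying_graph_has_cycle :: "'a pair_pre_digraph \<Rightarrow> bool" where
  "underlying_graph_has_cycle G \<longleftrightarrow>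
     (\<exists>p. pre_digraph.cycle (mk_symmetric G) p \<and> 3 \<le> length p)"

text \<open>Assignments on the vertex set are represented by functions on the whole type that
  vanish outside the vertex set, so that they are determined by their values on the vertices.\<close>

definition pebbling_assignment :: "'a pair_pre_digraph \<Rightarrow> ('a \<Rightarrow> nat) \<Rightarrow> bool" where
  "pebbling_assignment G S \<longleftrightarrow> (\<forall>v. v \<notin> pverts G \<longrightarrow> S v = 0)"

definition move_allowed :: "('a \<Rightarrow> nat) \<Rightarrow> 'a \<times> 'a \<Rightarrow> bool" where
  "move_allowed A e \<longleftrightarrow> 2 \<le> A (fst e)"

definition move_along :: "('a \<Rightarrow> nat) \<Rightarrow> 'a \<times> 'a \<Rightarrow> ('a \<Rightarrow> nat)" where
  "move_along A e = A(fst e := A (fst e) - 2, snd e := A (snd e) + 1)"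

definition pebbling_move :: "'a pair_pre_digraph \<Rightarrow> ('a \<Rightarrow> nat) \<Rightarrow> ('a \<Rightarrow> nat) \<Rightarrow> bool" where
  "pebbling_move G A B \<longleftrightarrow> (\<exists>e\<in>parcs G. move_allowed A e \<and> B = move_along A e)"

definition assignment_graph ::
    "'a pair_pre_digraph \<Rightarrow> ('a \<Rightarrow> nat) \<Rightarrow> ('a \<Rightarrow> nat) pair_pre_digraph" where
  "assignment_graph G S =
     \<lparr> pverts = {A. (pebbling_move G)\<^sup>*\<^sup>* S A},
       parcs = {(A, B). (pebbling_move G)\<^sup>*\<^sup>* S A \<and> pebbling_move G A B} \<rparr>"

definition fully_traversable :: "'a pair_pre_digraph \<Rightarrow> ('a \<Rightarrow> nat) \<Rightarrow> bool" where
  "fully_traversable G S \<longleftrightarrow>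
     parcs G \<noteq> {} \<and> (\<forall>e\<in>parcs G. \<exists>A\<in>pverts (assignment_graph G S). move_allowed A e)"

end

theory Submission
  imports Defs
begin

text \<open>
  If \<open>G\<close> is isomorphic to \<open>[S]\<close>, then both have the same number of arcs. Every arc of \<open>[S]\<close> is
  labelled by the arc of \<open>G\<close> along which the move is made, and full traversability says that
  every label occurs; hence every arc of \<open>G\<close> is the label of exactly one arc of \<open>[S]\<close>, that is, it
  can be used at exactly one reachable assignment. Consequently, after a move along \<open>(v, w)\<close> only
  moves starting in \<open>w\<close> are possible, for any other possible move would have been possible before
  as well. Tracking the pebbles through such a sequence of moves shows that no assignment arises
  from two different ones, so all in-degrees of \<open>[S]\<close>, and hence of \<open>G\<close>, are at most one. As the
  number of pebbles decreases along each arc, a vertex of an undirected cycle with the fewest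
  pebbles would have in-degree two.
\<close>

lemma pcas_nth_Suc:
  assumes "pcas u p v" and "Suc i < length p"
  shows "fst (p ! Suc i) = snd (p ! i)"
  using assms
proof (induction p arbitrary: u i)
  case (Cons e p)
  then show ?case by (cases i; cases p) auto
qed simp

lemma pcas_fst_hd: "pcas u p v \<Longrightarrow> p \<noteq> [] \<Longrightarrow> fst (hd p) = u"
  by (cases p) auto

lemma pcas_snd_last: "pcas u p v \<Longrightarrow> p \<noteq> [] \<Longrightarrow> snd (last p) = v"
  by (induction p arbitrary: u) auto

lemma pcas_closed_nth_mod:
  assumes "pcas u p u" and "i < length p"
  shows "fst (p ! (Suc i mod length p)) = snd (p ! i)"
proof (cases "Suc i = length p")
  case True
  have "p \<noteq> []" using assms by auto
  moreover from this have "p ! i = last p" and "p ! (Suc i mod length p) = hd p"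
    using True by (simp_all add: last_conv_nth hd_conv_nth flip: True)
  ultimately show ?thesis using assms pcas_fst_hd pcas_snd_last by metis
next
  case False
  then show ?thesis using assms pcas_nth_Suc[of u p u i] by simp
qed

lemma tl_pawalk_verts:
  assumes "pcas u p v"
  shows "tl (pawalk_verts u p) = map snd p"
  using assms
proof (induction p arbitrary: u)
  case (Cons e p)
  then show ?case by (cases p) auto
qed simp

lemma no_underlying_cycle:
  fixes rank :: "'a \<Rightarrow> nat"
  assumes rank: "\<And>u v. (u, v) \<in> parcs G \<Longrightarrow> rank v < rank u"
    and in_deg: "\<And>u v w. (u, w) \<in> parcs G \<Longrightarrow> (v, w) \<in> parcs G \<Longrightarrow> u = v"
  shows "\<not> underlying_graph_has_cycle G"
proof
  assume "underlying_graph_has_cycle G"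
  then obtain p u where arcs: "set p \<subseteq> parcs (mk_symmetric G)" and cas: "pcas u p u"
    and dist: "distinct (tl (pawalk_verts u p))" and len: "3 \<le> length p"
    by (auto simp: underlying_graph_has_cycle_def pre_digraph.cycle_def pre_digraph.awalk_def
        cas_with_proj_eq awalk_verts_with_proj_eq)
  \<comment> \<open>Dropping the repeated start vertex leaves the heads of the walk, so positions in
    \<open>p\<close> can stand for the vertices of the cycle.\<close>
  have dist: "distinct (map snd p)" using dist tl_pawalk_verts[OF cas] by simp
  define n where "n = length p"
  have n: "3 \<le> n" using len by (simp add: n_def)
  obtain i where i: "i < n" and min: "\<And>j. j < n \<Longrightarrow> rank (snd (p ! i)) \<le> rank (snd (p ! j))"
    using ex_is_arg_min_if_finite[of "{..<n}" "\<lambda>j. rank (snd (p ! j))"] n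
    by (auto simp: is_arg_min_linorder lessThan_empty_iff)
  define j where "j = Suc i mod n"
  \<comment> \<open>\<open>h\<close> and \<open>j\<close> are the cyclic predecessor and successor
    of \<open>i\<close>; adding \<open>n\<close> first avoids truncated subtraction at
    \<open>i = 0\<close>.\<close>
  define h where "h = (i + n - 1) mod n"
  have bounds: "j < n" "h < n" using n by (auto simp: j_def h_def)
  have "Suc h mod n = i" using i n by (simp add: h_def mod_Suc_eq)
  then have hi: "fst (p ! i) = snd (p ! h)"
    using pcas_closed_nth_mod[OF cas, of h] bounds by (simp add: n_def)
  have ij: "fst (p ! j) = snd (p ! i)"
    using pcas_closed_nth_mod[OF cas] i by (simp add: n_def j_def)
  \<comment> \<open>Here length at least 3 matters: for \<open>n = 2\<close> the two neighbours
    coincide.\<close>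
  have "h \<noteq> j"
  proof -
    consider "i = 0" | "0 < i" "Suc i = n" | "0 < i" "Suc i < n" using i by linarith
    then show ?thesis
    proof cases
      case 2
      then have "h = i - 1" "j = 0" using i by (auto simp: h_def j_def mod_if)
      then show ?thesis using 2 n by simp
    qed (use n i in \<open>auto simp: h_def j_def mod_if\<close>)
  qed
  then have "snd (p ! h) \<noteq> snd (p ! j)"
    using dist bounds by (auto simp: distinct_conv_nth n_def)
  \<comment> \<open>An arc leaving the vertex of least rank would lead to a smaller rank on the
    cycle, so its edges point inwards.\<close>
  moreover have arc: "(a, snd (p ! i)) \<in> parcs G"
    if "(a, snd (p ! i)) \<in> parcs G \<or> (snd (p ! i), a) \<in> parcs G" "a = snd (p ! k)" "k < n" for a k
    using that rank[of "snd (p ! i)" a] min[of k] by auto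
  have "p ! i \<in> parcs (mk_symmetric G)" "p ! j \<in> parcs (mk_symmetric G)"
    using arcs i bounds by (auto simp: n_def)
  then have "(snd (p ! h), snd (p ! i)) \<in> parcs G" "(snd (p ! j), snd (p ! i)) \<in> parcs G"
    using arc[of "snd (p ! h)" h] arc[of "snd (p ! j)" j] bounds hi ij
    by (auto simp: parcs_mk_symmetric)
  ultimately show False using in_deg by blast
qed

text \<open>Without loops, the tail is the only vertex that loses pebbles and the head the only one
  that gains.\<close>

lemma move_along_inj:
  assumes "move_allowed A e" "move_allowed A f" "fst e \<noteq> snd e" "fst f \<noteq> snd f"
    and eq: "move_along A e = move_along A f"
  shows "e = f"
proof -
  have "fst e = fst f"
    using assms(1-4) fun_cong[OF eq, of "fst e"]
    by (auto simp: move_allowed_def move_along_def split: if_splits)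
  moreover have "snd e = snd f"
    using assms(1-4) fun_cong[OF eq, of "snd e"]
    by (auto simp: move_allowed_def move_along_def split: if_splits)
  ultimately show ?thesis by (simp add: prod_eq_iff)
qed

lemma sum_move_along:
  assumes "finite V" "fst e \<in> V" "snd e \<in> V" "fst e \<noteq> snd e" "move_allowed A e"
  shows "sum A V = Suc (sum (move_along A e) V)"
proof -
  have V: "V = insert (fst e) (insert (snd e) (V - {fst e, snd e}))" using assms by auto
  have rest: "sum (move_along A e) (V - {fst e, snd e}) = sum A (V - {fst e, snd e})"
    by (rule sum.cong) (auto simp: move_along_def)
  show ?thesis
    using assms rest by (subst (1 2) V) (auto simp: move_along_def move_allowed_def)
qed

text \<open>The in-degree bound needs only this consequence of the arc count, so it is derived
  without mentioning an isomorphism.\<close>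

locale single_use_pebbling =
  fixes G :: "'a pair_pre_digraph" and S :: "'a \<Rightarrow> nat"
  assumes digraph: "pair_digraph G"
    and single_use: "\<And>A B e. (pebbling_move G)\<^sup>*\<^sup>* S A \<Longrightarrow> (pebbling_move G)\<^sup>*\<^sup>* S B \<Longrightarrow>
      e \<in> parcs G \<Longrightarrow> move_allowed A e \<Longrightarrow> move_allowed B e \<Longrightarrow> A = B"
begin

lemma arc_ends_neq: "e \<in> parcs G \<Longrightarrow> fst e \<noteq> snd e"
  using pair_digraph.axioms(2)[OF digraph] pair_loopfree_digraph.no_loops' by (cases e) force

lemma pebbles_pebbling_move:
  assumes "pebbling_move G A B"
  shows "sum A (pverts G) = Suc (sum B (pverts G))"
proof -
  interpret pair_digraph G by (rule digraph)
  show ?thesis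
    using assms sum_move_along[OF pair_finite_verts arc_fst_in_verts arc_snd_in_verts arc_ends_neq]
    unfolding pebbling_move_def by blast
qed

lemma next_move_tail:
  assumes reach: "(pebbling_move G)\<^sup>*\<^sup>* S A" and e: "e \<in> parcs G" "move_allowed A e"
    and f: "f \<in> parcs G" "move_allowed (move_along A e) f"
  shows "fst f = snd e"
proof (rule ccontr)
  assume "fst f \<noteq> snd e"
  with f have "move_allowed A f"
    by (auto simp: move_allowed_def move_along_def split: if_splits)
  moreover have move: "pebbling_move G A (move_along A e)" using e by (auto simp: pebbling_move_def)
  ultimately have "A = move_along A e"
    using single_use[of A "move_along A e" f] reach f by (meson rtranclp.rtrancl_into_rtrancl)
  then show False using pebbles_pebbling_move[OF move] by simp
qed

text \<open>A surplus over \<open>S\<close> travels with the moves: each move spends it at its tail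
  and leaves at most one extra pebble at its head, where the next move must start.\<close>

lemma pebbles_le_if_move_allowed:
  assumes "(pebbling_move G)\<^sup>*\<^sup>* S A" and "e \<in> parcs G" "move_allowed A e"
  shows "A x \<le> S x + of_bool (x = fst e)"
  using assms
proof (induction arbitrary: e x rule: rtranclp_induct)
  case (step A B)
  then obtain f where f: "f \<in> parcs G" "move_allowed A f" "B = move_along A f"
    by (auto simp: pebbling_move_def)
  have "fst e = snd f" using next_move_tail[of A f e] step f by simp
  then show ?case
    using step.IH[OF f(1,2), of x] f arc_ends_neq[of f]
    by (auto simp: move_along_def move_allowed_def)
qed simp

text \<open>A vertex loses pebbles only as the tail of a move, made at an earlier assignment; the
  larger total there later tells the two assignments apart.\<close>

lemma pebbles_ge_or_used:
  assumes "(pebbling_move G)\<^sup>*\<^sup>* S A"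
  shows "S v \<le> A v \<or> (\<exists>B. (pebbling_move G)\<^sup>*\<^sup>* S B \<and> 2 \<le> B v \<and> sum A (pverts G) < sum B (pverts G))"
  using assms
proof (induction rule: rtranclp_induct)
  case (step A B)
  then obtain f where f: "f \<in> parcs G" "move_allowed A f" "B = move_along A f"
    by (auto simp: pebbling_move_def)
  have less: "sum B (pverts G) < sum A (pverts G)"
    using pebbles_pebbling_move[OF step.hyps(2)] by simp
  show ?case
  proof (cases "v = fst f")
    case True
    then show ?thesis using f less step.hyps by (auto simp: move_allowed_def)
  next
    case False
    then have "A v \<le> B v" using f by (auto simp: move_along_def)
    then show ?thesis using step.IH less by (meson le_trans less_trans)
  qed
qed simp

lemma pebbling_move_pred_unique:
  assumes reach: "(pebbling_move G)\<^sup>*\<^sup>* S A\<^sub>1" "(pebbling_move G)\<^sup>*\<^sup>* S A\<^sub>2"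
    and moves: "pebbling_move G A\<^sub>1 B" "pebbling_move G A\<^sub>2 B"
  shows "A\<^sub>1 = A\<^sub>2"
proof (rule ccontr)
  assume neq: "A\<^sub>1 \<noteq> A\<^sub>2"
  obtain e f where e: "e \<in> parcs G" "move_allowed A\<^sub>1 e" "B = move_along A\<^sub>1 e"
    and f: "f \<in> parcs G" "move_allowed A\<^sub>2 f" "B = move_along A\<^sub>2 f"
    using moves by (auto simp: pebbling_move_def)
  have sums: "sum A\<^sub>1 (pverts G) = sum A\<^sub>2 (pverts G)" using moves pebbles_pebbling_move by metis
  \<comment> \<open>Whether a move is allowed depends only on its tail, so a common tail would make
    \<open>e\<close> usable at both assignments.\<close>
  have "fst e \<noteq> fst f"
    using single_use[OF reach e(1,2)] neq f by (auto simp: move_allowed_def)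
  then have "A\<^sub>1 (fst f) \<le> B (fst f)" using e by (auto simp: move_along_def)
  moreover have "B (fst f) + 2 = A\<^sub>2 (fst f)"
    using f arc_ends_neq[of f] by (auto simp: move_along_def move_allowed_def)
  moreover have "A\<^sub>2 (fst f) \<le> S (fst f) + 1"
    using pebbles_le_if_move_allowed[OF reach(2) f(1,2), of "fst f"] by simp
  \<comment> \<open>Otherwise \<open>f\<close> was already usable at an assignment with more pebbles
    than \<open>A\<^sub>1\<close>, hence more than \<open>A\<^sub>2\<close>, against single
    use.\<close>
  moreover have "S (fst f) \<le> A\<^sub>1 (fst f)"
    using pebbles_ge_or_used[OF reach(1), of "fst f"] single_use[OF _ reach(2) f(1) _ f(2)] sums
    by (auto simp: move_allowed_def)
  ultimately show False by linarith
qed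

end

text \<open>The pairs in \<open>X\<close> inject into the arcs of the assignment graph and project
  onto those of \<open>G\<close>, so the projection is a bijection. Finiteness is assumed separately
  because \<open>card\<close> is 0 on infinite sets.\<close>

lemma single_use_if_card_arcs_le:
  assumes digraph: "pair_digraph G" and trav: "fully_traversable G S"
    and fin: "finite (parcs (assignment_graph G S))"
    and card: "card (parcs (assignment_graph G S)) \<le> card (parcs G)"
  shows "single_use_pebbling G S"
proof -
  interpret pair_digraph G by (rule digraph)
  let ?reach = "(pebbling_move G)\<^sup>*\<^sup>* S"
  define X where "X = {(A, e). ?reach A \<and> e \<in> parcs G \<and> move_allowed A e}"
  let ?arc = "\<lambda>(A, e). (A, move_along A e)"
  have "fst e \<noteq> snd e" if "e \<in> parcs G" for e using that no_loops' by (cases e) auto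
  then have inj: "inj_on ?arc X"
    by (auto simp: X_def simp del: split_paired_All intro!: inj_onI dest: move_along_inj)
  have sub: "?arc ` X \<subseteq> parcs (assignment_graph G S)"
    by (auto simp: X_def assignment_graph_def pebbling_move_def)
  have finX: "finite X" using inj sub fin by (meson finite_imageD finite_subset)
  have snd: "snd ` X = parcs G"
    using trav by (force simp: X_def fully_traversable_def assignment_graph_def)
  have "card X \<le> card (parcs G)"
    using card_inj_on_le[OF inj sub fin] card by simp
  then have "card (snd ` X) = card X"
    using card_image_le[OF finX, of snd] snd by simp
  then have "inj_on snd X" using finX by (simp add: eq_card_imp_inj_on)
  then show ?thesis
    by unfold_locales (auto simp: X_def inj_on_def)
qed

theorem theorem4p1:
  fixes G :: "'a pair_pre_digraph" and S :: "'a \<Rightarrow> nat"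
  assumes "finite_oriented_graph G"
    and "pebbling_assignment G S"
    and "fully_traversable G S"
    and "underlying_graph_has_cycle G"
  shows "\<not> digraph_iso (with_proj G) (with_proj (assignment_graph G S))"
proof
  assume "digraph_iso (with_proj G) (with_proj (assignment_graph G S))"
  then obtain f where f: "pre_digraph.digraph_isomorphism (with_proj G) f"
    and eq: "with_proj (assignment_graph G S) = app_iso f (with_proj G)"
    by (auto simp: digraph_iso_def)
  have digraph: "pair_digraph G" using assms(1) by (simp add: finite_oriented_graph_def)
  interpret pair_digraph G by (rule digraph)
  \<comment> \<open>Comparing the record fields \<open>tail\<close> and \<open>head\<close> forces
    each arc to map to the pair of the images of its ends.\<close>
  have arcs: "parcs (assignment_graph G S) = iso_arcs f ` parcs G"
    and ends: "iso_tail f = fst" "iso_head f = snd"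
    using arg_cong[OF eq, of arcs] arg_cong[OF eq, of tail] arg_cong[OF eq, of head] by simp_all
  interpret single_use_pebbling G S
    by (rule single_use_if_card_arcs_le[OF digraph assms(3)]) (simp_all add: arcs card_image_le)
  define \<phi> where "\<phi> = iso_verts f"
  have \<phi>: "(\<phi> u, \<phi> v) \<in> parcs (assignment_graph G S)" if "(u, v) \<in> parcs G" for u v
  proof -
    have "iso_arcs f (u, v) = (\<phi> u, \<phi> v)"
      using f that by (auto simp: pre_digraph.digraph_isomorphism_def ends \<phi>_def prod_eq_iff)
    then show ?thesis using that arcs by force
  qed
  have inj: "inj_on \<phi> (pverts G)"
    using f by (simp add: pre_digraph.digraph_isomorphism_def \<phi>_def)
  have "\<not> underlying_graph_has_cycle G"
  proof (rule no_underlying_cycle)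
    \<comment> \<open>The rank of a vertex is the pebble total of its corresponding
      assignment.\<close>
    show "sum (\<phi> v) (pverts G) < sum (\<phi> u) (pverts G)" if "(u, v) \<in> parcs G" for u v
      using \<phi>[OF that] pebbles_pebbling_move[of "\<phi> u" "\<phi> v"] by (simp add: assignment_graph_def)
    show "u = v" if "(u, w) \<in> parcs G" "(v, w) \<in> parcs G" for u v w
      using \<phi>[OF that(1)] \<phi>[OF that(2)] pebbling_move_pred_unique[of "\<phi> u" "\<phi> v" "\<phi> w"]
        inj_onD[OF inj] arc_fst_in_verts[OF that(1)] arc_fst_in_verts[OF that(2)]
      by (auto simp: assignment_graph_def)
  qed
  with assms(4) show False by contradiction
qed

end
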